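(* Let $\Phi\in\mathbb{R}^{\ell\times N}$ with $\ell<N$ satisfy the null space property of order $K$ for $\gamma\in(0,1)$, let $y\in\mathbb{R}^\ell$, and suppose that $\Phi^{-1}(y):=\{x\in\mathbb{R}^N\mid \Phi x=y\}$ contains a $K$-sparse vector $x^*$. Let $\eta\in(0,1)$ and let $\{x^n\}$ be generated by the modified IRLS algorithm, described in the context, from an initial point $x^0\in\mathbb{R}^N$. Set $T:=\{i \mid x^*_i\ne0,\ 1\le i\le N\}$ and choose $\rho\in\left(0,\,1-\gamma(1+\eta(1-\gamma))\right)$. Then there is a smallest $n_0\in\mathbb{N}=\{1,2,\dots\}$ such that $$\|(x^{n_0}-x^* )_{T^c}\|_1\le\rho\min_{i\in T}|x^*_i| .$$ Moreover, for all $n\ge n_0$, $$\|(x^{n+1}-x^* )_{T^c}\|_1\le\mu\,\|(x^n-x^* )_{T^c}\|_1,$$ $$\|x^n-x^*\|_1\le(1+\gamma)\,\mu^{\,n-n_0}\,\|x^{n_0}-x^*\|_1,$$ where $\mu:=\dfrac{\gamma(1+\eta(1-\gamma))}{1-\rho}<1$.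
   Context: Notation. For $x\in\mathbb{R}^N$, $r_i(x)$ is the $i$-th largest element (counted with multiplicity) of $|x_1|,\dots,|x_N|$, and $\sigma_j(x):=\sum_{\nu>j}r_\nu(x)$. A vector is $K$-sparse if it has at most $K$ non-zero components. For $S\subseteq\{1,\dots,N\}$, $x_S\in\mathbb{R}^N$ is the vector with $(x_S)_i=x_i$ for $i\in S$ and $(x_S)_i=0$ otherwise; $S^c$ is the complement of $S$ in $\{1,\dots,N\}$. A minimum over the empty set is $+\infty$. For a positive weight vector $w\in\mathbb{R}^N$, $\|u\|_w:=\big(\sum_{i=1}^N w_iu_i^2\big)^{1/2}$. Null space property (NSP). $\Phi\in\mathbb{R}^{\ell\times N}$ satisfies the NSP of order $K$ (a positive integer) for $\gamma\in(0,1)$ if $\|z_T\|_1\le\gamma\|z_{T^c}\|_1$ for all $z\in\mathrm{Null}(\Phi)$ and all index sets $T\subset\{1,\dots,N\}$ of cardinality not exceeding $K$. Modified IRLS algorithm. The parameters $K,\gamma$ are those of the NSP, and $\eta\in(0,1)$ is fixed. Start with $x^0\in\mathbb{R}^N$ and $\epsilon_0=1$. For $n=0,1,2,\dots$: - set $w^n_i:=((x^n_i)^2+\epsilon_n^2)^{-1/2}$ for $i=1,\dots,N$; - set $x^{n+1}:=\operatorname{argmin}\{\|x\|_{w^n}^2 \mid x\in\Phi^{-1}(y)\}$; - set $\epsilon_{n+1}:=\min\left\{\epsilon_n,\ \frac{\eta(1-\gamma)\sigma_K(x^{n+1})}{N}\right\}$; - if $\epsilon_{n+1}=0$, stop with output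 $x^{n+1}$. If the algorithm stops with $\epsilon_{m}=0$, the sequences are understood to be continued by $x^n:=x^{m}$ and $\epsilon_n:=0$ for all $n\ge m$. *)

theory Defs
  imports "HOL-Analysis.Analysis" "HOL-Library.Multiset" "HOL-Library.Extended_Real"
begin

definition l1_norm :: "real ^ 'n \<Rightarrow> real" where
  "l1_norm x = (\<Sum>i\<in>UNIV. \<bar>x $ i\<bar>)"

definition vec_restrict :: "'n set \<Rightarrow> real ^ 'n \<Rightarrow> real ^ 'n" where
  "vec_restrict S x = (\<chi> i. if i \<in> S then x $ i else 0)"

definition vec_support :: "real ^ 'n \<Rightarrow> 'n set" where
  "vec_support x = {i. x $ i \<noteq> 0}"

definition k_sparse :: "nat \<Rightarrow> real ^ 'n \<Rightarrow> bool" where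
  "k_sparse K x \<longleftrightarrow> card (vec_support x) \<le> K"

text \<open>
  The \<open>i\<close>-th largest modulus is counted from \<open>i = 1\<close>, whereas list indices start at \<open>0\<close>;
  it is meaningful only for \<open>1 \<le> i \<le> CARD('n)\<close>.
\<close>

definition nth_largest_abs :: "nat \<Rightarrow> real ^ 'n \<Rightarrow> real" where
  "nth_largest_abs i x =
     rev (sorted_list_of_multiset (image_mset (\<lambda>k. \<bar>x $ k\<bar>) (mset_set UNIV))) ! (i - 1)"

definition sigma_tail :: "nat \<Rightarrow> real ^ 'n \<Rightarrow> real" where
  "sigma_tail j x = (\<Sum>\<nu>\<in>{j<..CARD('n)}. nth_largest_abs \<nu> x)"

definition min_or_infty :: "real set \<Rightarrow> ereal" where
  "min_or_infty A = (if A = {} then \<infinity> else ereal (Min A))"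

definition weighted_norm :: "real ^ 'n \<Rightarrow> real ^ 'n \<Rightarrow> real" where
  "weighted_norm w u = sqrt (\<Sum>i\<in>UNIV. w $ i * (u $ i)\<^sup>2)"

definition null_space_property :: "real ^ 'n ^ 'l \<Rightarrow> nat \<Rightarrow> real \<Rightarrow> bool" where
  "null_space_property \<Phi> K \<gamma> \<longleftrightarrow>
     (\<forall>z. \<Phi> *v z = 0 \<longrightarrow>
       (\<forall>T. card T \<le> K \<longrightarrow>
         l1_norm (vec_restrict T z) \<le> \<gamma> * l1_norm (vec_restrict (- T) z)))"

definition irls_weight :: "real ^ 'n \<Rightarrow> real \<Rightarrow> real ^ 'n" where
  "irls_weight x e = (\<chi> i. ((x $ i)\<^sup>2 + e\<^sup>2) powr (- 1 / 2))"

text \<open>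
  \<open>x\<close> and \<open>\<epsilon>\<close> are the sequences produced by the modified IRLS algorithm from the initial point
  \<open>x 0\<close>. Once \<open>\<epsilon> n = 0\<close> the algorithm has stopped and both sequences are continued as constants.
  Before that all weights are positive, so the squared weighted norm has at most one minimiser
  on the affine set, and \<open>is_arg_min\<close> says that \<open>x (Suc n)\<close> is this minimiser.
\<close>

definition modified_irls ::
  "real ^ 'n ^ 'l \<Rightarrow> real ^ 'l \<Rightarrow> nat \<Rightarrow> real \<Rightarrow> real \<Rightarrow> (nat \<Rightarrow> real ^ 'n) \<Rightarrow> (nat \<Rightarrow> real) \<Rightarrow> bool"
where
  "modified_irls \<Phi> y K \<gamma> \<eta> x \<epsilon> \<longleftrightarrow>
     \<epsilon> 0 = 1 \<and>
     (\<forall>n. if \<epsilon> n = 0 then x (Suc n) = x n \<and> \<epsilon> (Suc n) = 0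
          else is_arg_min (\<lambda>u. (weighted_norm (irls_weight (x n) (\<epsilon> n)) u)\<^sup>2)
                 (\<lambda>u. \<Phi> *v u = y) (x (Suc n)) \<and>
               \<epsilon> (Suc n) =
                 min (\<epsilon> n) (\<eta> * (1 - \<gamma>) * sigma_tail K (x (Suc n)) / real CARD('n)))"

end

theory Submission
  imports Defs
begin

text \<open>
  Let \<open>err n\<close> be the \<open>\<ell>\<^sub>1\<close> norm of \<open>x n - xstar\<close> off the support of \<open>xstar\<close>. If \<open>err n\<close> is small against
  the nonzero entries of \<open>xstar\<close>, the weights on the support are controlled; testing the optimality
  of \<open>x (Suc n)\<close> against \<open>x (Suc n) - xstar\<close>, the null space property and the Cauchy-Schwarz
  inequality then give the contraction, which also preserves the smallness.

  That \<open>err n\<close> becomes small needs no compactness. If some \<open>\<epsilon> n\<close> is small, then at the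
  first such index it is a multiple of \<open>sigma_tail K (x n)\<close>, which dominates \<open>err n\<close> by the null
  space property. If the \<open>\<epsilon> n\<close> stay away from \<open>0\<close>, the smoothed \<open>\<ell>\<^sub>1\<close> norm
  of \<open>x n\<close> decreases and hence its decrements tend to \<open>0\<close>; by convexity and
  \<open>\<epsilon> n \<le> \<eta> (1 - \<gamma>) err n / N\<close> these decrements bound a multiple of the square of \<open>err n\<close>.
\<close>

section \<open>Sums of moduli and best sparse approximation\<close>

lemma l1_norm_vec_restrict: "l1_norm (vec_restrict S x) = (\<Sum>i\<in>S. \<bar>x $ i\<bar>)"
proof -
  have "l1_norm (vec_restrict S x) = (\<Sum>i\<in>UNIV. if i \<in> S then \<bar>x $ i\<bar> else 0)"
    unfolding l1_norm_def vec_restrict_def by (intro sum.cong) auto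
  then show ?thesis
    by (simp add: sum.inter_restrict[symmetric])
qed

lemma l1_norm_split: "l1_norm x = (\<Sum>i\<in>S. \<bar>x $ i\<bar>) + (\<Sum>i\<in>- S. \<bar>x $ i\<bar>)"
  unfolding l1_norm_def
  by (metis Compl_partition Int_commute Compl_disjoint finite sum.union_disjoint)

text \<open>Exchange argument: \<open>T - S\<close> has at most as many elements as
  \<open>S - T\<close>, so it injects into \<open>S - T\<close>, and no term decreases along the
  injection.\<close>

lemma sum_le_sum_dominating:
  fixes f :: "'a \<Rightarrow> real"
  assumes "finite S" "finite T" "card T \<le> card S"
    and nonneg: "\<And>i. i \<in> S \<Longrightarrow> 0 \<le> f i"
    and dom: "\<And>i j. i \<in> S \<Longrightarrow> j \<notin> S \<Longrightarrow> f j \<le> f i"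
  shows "sum f T \<le> sum f S"
proof -
  have "card (T - S) \<le> card (S - T)"
    using card_Int_Diff[OF assms(1), of T] card_Int_Diff[OF assms(2), of S] assms(3)
    by (simp add: Int_commute)
  then obtain g where g: "g ` (T - S) \<subseteq> S - T" "inj_on g (T - S)"
    using card_le_inj[of "T - S" "S - T"] assms(1,2) by auto
  have "sum f (T - S) \<le> (\<Sum>t\<in>T - S. f (g t))"
    using g(1) by (intro sum_mono dom) auto
  also have "\<dots> = sum f (g ` (T - S))"
    by (simp add: sum.reindex[OF g(2)])
  also have "\<dots> \<le> sum f (S - T)"
    using g(1) assms(1) nonneg by (intro sum_mono2) auto
  finally have "sum f (T - S) \<le> sum f (S - T)" .
  then show ?thesis
    using sum.Int_Diff[OF assms(1), of f T] sum.Int_Diff[OF assms(2), of f S]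
    by (simp add: Int_commute)
qed

text \<open>\<open>S\<close> collects the first \<open>K\<close> positions in a list of all indices
  sorted by decreasing modulus. Sorting indices instead of values links the list in
  \<open>nth_largest_abs\<close> to index sets even when moduli coincide.\<close>

lemma sigma_tail_best_approximation:
  fixes x :: "real ^ 'n"
  obtains S :: "'n set" where "card S \<le> K" "sigma_tail K x = (\<Sum>i\<in>- S. \<bar>x $ i\<bar>)"
    "\<And>T. card T \<le> K \<Longrightarrow> (\<Sum>i\<in>- S. \<bar>x $ i\<bar>) \<le> (\<Sum>i\<in>- T. \<bar>x $ i\<bar>)"
proof -
  let ?f = "\<lambda>i. \<bar>x $ i\<bar>"
  obtain l :: "'n list" where l: "set l = UNIV" "distinct l"
    using finite_distinct_list[OF finite] by blast
  define ks where "ks = rev (sort_key ?f l)"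
  have ks: "set ks = UNIV" "distinct ks"
    using l by (auto simp: ks_def)
  have len: "length ks = CARD('n)"
    using ks distinct_card by metis
  have msetks: "mset_set UNIV = mset ks"
    using ks by (metis mset_set_set)
  have desc: "sorted (rev (map ?f ks))"
    unfolding ks_def by (simp add: rev_map[symmetric])
  have sl: "sorted_list_of_multiset (image_mset ?f (mset_set UNIV)) = rev (map ?f ks)"
    using desc by (metis msetks mset_map mset_rev sorted_list_of_multiset_mset sort_key_id_if_sorted sorted_sort_id)
  have nth: "nth_largest_abs (Suc \<nu>) x = ?f (ks ! \<nu>)" if "\<nu> < CARD('n)" for \<nu>
    using that len by (simp add: nth_largest_abs_def sl)
  define S where "S = set (take K ks)"
  have compl: "- S = set (drop K ks)"
  proof -
    have "set (take K ks) \<inter> set (drop K ks) = {}"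
      using ks(2) by (metis append_take_drop_id distinct_append)
    moreover have "set (take K ks) \<union> set (drop K ks) = UNIV"
      using ks(1) by (metis append_take_drop_id set_append)
    ultimately show ?thesis unfolding S_def by blast
  qed
  have cardS: "card S = min K CARD('n)"
    unfolding S_def using ks(2) len by (simp add: distinct_card min.commute)
  have dom: "?f j \<le> ?f i" if "i \<in> S" "j \<notin> S" for i j
  proof -
    have j: "j \<in> set (drop K ks)" using that compl by auto
    have "map ?f ks = map ?f (take K ks) @ map ?f (drop K ks)"
      by (metis append_take_drop_id map_append)
    then have "sorted (rev (map ?f (drop K ks)) @ rev (map ?f (take K ks)))"
      using desc by simp
    then show ?thesis
      using that(1) j by (auto simp: sorted_append S_def)
  qed
  show ?thesis
  proof (rule that)
    show "card S \<le> K" using cardS by simp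
    \<comment> \<open>Ranks start at 1 and list positions at 0, so the ranks beyond \<open>K\<close>
      are the positions from \<open>K\<close> on.\<close>
    have "sigma_tail K x = (\<Sum>\<nu>\<in>{K..<CARD('n)}. nth_largest_abs (Suc \<nu>) x)"
      unfolding sigma_tail_def
      by (rule sum.reindex_bij_witness[of _ Suc "\<lambda>\<nu>. \<nu> - 1"]) auto
    also have "\<dots> = (\<Sum>\<nu>\<in>{K..<CARD('n)}. ?f (ks ! \<nu>))"
      by (intro sum.cong) (auto simp: nth)
    also have "\<dots> = (\<Sum>\<nu>\<in>{0..<CARD('n) - K}. ?f (drop K ks ! \<nu>))"
      using len by (intro sum.reindex_bij_witness[of _ "\<lambda>\<nu>. \<nu> + K" "\<lambda>\<nu>. \<nu> - K"])
        (auto simp: add.commute)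
    also have "\<dots> = sum_list (map ?f (drop K ks))"
      using len by (simp add: sum_list_sum_nth)
    also have "\<dots> = sum ?f (set (drop K ks))"
      using ks(2) by (simp add: sum_list_distinct_conv_sum_set)
    finally show "sigma_tail K x = sum ?f (- S)" by (simp add: compl)
    fix T :: "'n set" assume "card T \<le> K"
    \<comment> \<open>If \<open>K\<close> exceeds the dimension, \<open>S\<close> is the whole index
      set, so both bounds on the cardinality of \<open>T\<close> enter.\<close>
    moreover have "card T \<le> CARD('n)" by (simp add: card_mono)
    ultimately have "sum ?f T \<le> sum ?f S"
      using dom cardS by (intro sum_le_sum_dominating) auto
    then show "sum ?f (- S) \<le> sum ?f (- T)"
      using l1_norm_split[of x S] l1_norm_split[of x T] by linarith
  qed
qed

lemma sigma_tail_nonneg: "0 \<le> sigma_tail K x"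
proof -
  obtain S where "sigma_tail K x = (\<Sum>i\<in>- S. \<bar>x $ i\<bar>)"
    by (rule sigma_tail_best_approximation)
  then show ?thesis by (simp add: sum_nonneg)
qed

lemma sigma_tail_le:
  assumes "card T \<le> K"
  shows "sigma_tail K x \<le> (\<Sum>i\<in>- T. \<bar>x $ i\<bar>)"
  using sigma_tail_best_approximation assms by metis

section \<open>Weighted least squares\<close>

lemma weighted_Cauchy_Schwarz:
  fixes w a b :: "'a \<Rightarrow> real"
  assumes "\<And>i. i \<in> I \<Longrightarrow> 0 \<le> w i"
  shows "(\<Sum>i\<in>I. w i * a i * b i)\<^sup>2 \<le> (\<Sum>i\<in>I. w i * (a i)\<^sup>2) * (\<Sum>i\<in>I. w i * (b i)\<^sup>2)"
proof -
  have "(\<Sum>i\<in>I. (sqrt (w i) * a i) * (sqrt (w i) * b i))\<^sup>2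
      \<le> (\<Sum>i\<in>I. (sqrt (w i) * a i)\<^sup>2) * (\<Sum>i\<in>I. (sqrt (w i) * b i)\<^sup>2)"
    by (rule Cauchy_Schwarz_ineq_sum)
  moreover have "(\<Sum>i\<in>I. (sqrt (w i) * a i) * (sqrt (w i) * b i)) = (\<Sum>i\<in>I. w i * a i * b i)"
    using assms by (intro sum.cong) (simp_all add: algebra_simps flip: power2_eq_square)
  moreover have "(\<Sum>i\<in>I. (sqrt (w i) * c i)\<^sup>2) = (\<Sum>i\<in>I. w i * (c i)\<^sup>2)" for c :: "'a \<Rightarrow> real"
    using assms by (intro sum.cong) (simp_all add: power_mult_distrib)
  ultimately show ?thesis by simp
qed

lemma quadratic_nonneg_imp_linear_zero:
  fixes A B :: real
  assumes "0 \<le> A" and "\<And>t. 0 \<le> 2 * t * B + t\<^sup>2 * A"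
  shows "B = 0"
proof -
  \<comment> \<open>The vertex of the parabola is at \<open>- B / A\<close>; the denominator
    \<open>A + 1\<close> also covers \<open>A = 0\<close> and still gives a negative value unless
    \<open>B = 0\<close>.\<close>
  have "0 \<le> 2 * (- B / (A + 1)) * B + (- B / (A + 1))\<^sup>2 * A"
    by (rule assms)
  also have "\<dots> = - (B\<^sup>2 * (A + 2)) / (A + 1)\<^sup>2"
    using assms(1) by (simp add: divide_simps power2_eq_square) (simp add: algebra_simps)
  finally have "B\<^sup>2 * (A + 2) \<le> 0"
    using assms(1) by (simp add: zero_le_divide_iff divide_le_0_iff)
  then show ?thesis
    using assms(1) by (simp add: mult_le_0_iff)
qed

text \<open>First variation: every \<open>u + t *\<^sub>R v\<close> is feasible, so the objective as
  a quadratic in \<open>t\<close> is minimal at \<open>t = 0\<close> and its linear coefficient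
  vanishes.\<close>

lemma weighted_minimiser_orthogonal:
  fixes \<Phi> :: "real ^ 'n ^ 'l"
  assumes w: "\<And>i. 0 \<le> w $ i"
    and min: "is_arg_min (\<lambda>u. (weighted_norm w u)\<^sup>2) (\<lambda>u. \<Phi> *v u = y) u"
    and v: "\<Phi> *v v = 0"
  shows "(\<Sum>i\<in>UNIV. w $ i * u $ i * v $ i) = 0"
proof (rule quadratic_nonneg_imp_linear_zero)
  show "0 \<le> (\<Sum>i\<in>UNIV. w $ i * (v $ i)\<^sup>2)"
    using w by (simp add: sum_nonneg)
  fix t :: real
  have sq: "(weighted_norm w z)\<^sup>2 = (\<Sum>i\<in>UNIV. w $ i * (z $ i)\<^sup>2)" for z
    unfolding weighted_norm_def using w by (simp add: sum_nonneg)
  have "\<Phi> *v (u + t *\<^sub>R v) = y"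
    using min v by (simp add: is_arg_min_def matrix_vector_right_distrib matrix_vector_mult_scaleR)
  then have "(weighted_norm w u)\<^sup>2 \<le> (weighted_norm w (u + t *\<^sub>R v))\<^sup>2"
    using min by (auto simp: is_arg_min_linorder)
  also have "\<dots> = (weighted_norm w u)\<^sup>2 + 2 * t * (\<Sum>i\<in>UNIV. w $ i * u $ i * v $ i)
      + t\<^sup>2 * (\<Sum>i\<in>UNIV. w $ i * (v $ i)\<^sup>2)"
    unfolding sq sum_distrib_left sum.distrib[symmetric]
    by (intro sum.cong) (simp_all add: power2_eq_square algebra_simps)
  finally show "0 \<le> 2 * t * (\<Sum>i\<in>UNIV. w $ i * u $ i * v $ i)
      + t\<^sup>2 * (\<Sum>i\<in>UNIV. w $ i * (v $ i)\<^sup>2)" by simp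
qed

section \<open>Tangent bounds for the smoothed modulus\<close>

lemma irls_weight_nth: "irls_weight x e $ i = 1 / sqrt ((x $ i)\<^sup>2 + e\<^sup>2)"
proof -
  have "s powr (- 1 / 2) = 1 / sqrt s" if "0 \<le> s" for s :: real
    using powr_minus[of s "1 / 2"] that by (simp add: powr_half_sqrt inverse_eq_divide)
  then show ?thesis
    unfolding irls_weight_def by simp
qed

text \<open>Concavity of the square root: the gap to the tangent is
  \<open>(sqrt a - sqrt b)\<^sup>2 / (2 * sqrt b)\<close>. The slope at a squared scale is half an
  IRLS weight.\<close>

lemma sqrt_le_tangent:
  assumes "0 \<le> a" "0 < b"
  shows "sqrt a \<le> sqrt b + (a - b) / (2 * sqrt b)"
proof -
  have "(p - q) * (2 * q) = p\<^sup>2 - q\<^sup>2 - (p - q)\<^sup>2" for p q :: real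
    by (simp add: power2_eq_square algebra_simps)
  from this[of "sqrt a" "sqrt b"] have "(sqrt a - sqrt b) * (2 * sqrt b) \<le> a - b"
    using assms by simp
  then have "sqrt a - sqrt b \<le> (a - b) / (2 * sqrt b)"
    using assms by (simp add: pos_le_divide_eq)
  then show ?thesis by simp
qed

text \<open>Convexity in the entry for fixed \<open>e\<close>; the core is the Cauchy-Schwarz
  inequality for the vectors \<open>(a, e)\<close> and \<open>(b, e)\<close>.\<close>

lemma sqrt_sq_add_ge_tangent:
  fixes a b e :: real
  assumes "e \<noteq> 0"
  shows "sqrt (a\<^sup>2 + e\<^sup>2) + a * (b - a) / sqrt (a\<^sup>2 + e\<^sup>2) \<le> sqrt (b\<^sup>2 + e\<^sup>2)"
proof -
  have pos: "0 < a\<^sup>2 + e\<^sup>2" using assms by (simp add: add_nonneg_pos)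
  have "a * b + e * e \<le> sqrt (a\<^sup>2 + e\<^sup>2) * sqrt (b\<^sup>2 + e\<^sup>2)"
  proof (rule power2_le_imp_le)
    have "0 \<le> (a * e - b * e)\<^sup>2" by simp
    also have "\<dots> = (a\<^sup>2 + e\<^sup>2) * (b\<^sup>2 + e\<^sup>2) - (a * b + e * e)\<^sup>2"
      by (simp add: power2_eq_square algebra_simps)
    finally show "(a * b + e * e)\<^sup>2 \<le> (sqrt (a\<^sup>2 + e\<^sup>2) * sqrt (b\<^sup>2 + e\<^sup>2))\<^sup>2"
      by (simp add: power_mult_distrib)
  qed simp
  then have "(a\<^sup>2 + e\<^sup>2) + a * (b - a) \<le> sqrt (b\<^sup>2 + e\<^sup>2) * sqrt (a\<^sup>2 + e\<^sup>2)"
    by (simp add: power2_eq_square algebra_simps)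
  then have "((a\<^sup>2 + e\<^sup>2) + a * (b - a)) / sqrt (a\<^sup>2 + e\<^sup>2) \<le> sqrt (b\<^sup>2 + e\<^sup>2)"
    using pos by (simp add: pos_divide_le_eq)
  then show ?thesis
    using pos real_div_sqrt[of "a\<^sup>2 + e\<^sup>2"] by (simp only: add_divide_distrib[of "a\<^sup>2 + e\<^sup>2"])
qed

section \<open>Consequences of the null space property\<close>

lemma null_space_propertyD:
  assumes "null_space_property \<Phi> K \<gamma>" "\<Phi> *v z = 0" "card T \<le> K"
  shows "(\<Sum>i\<in>T. \<bar>z $ i\<bar>) \<le> \<gamma> * (\<Sum>i\<in>- T. \<bar>z $ i\<bar>)"
  using assms unfolding null_space_property_def l1_norm_vec_restrict by blast

text \<open>The triangle inequality bounds \<open>u\<close> by \<open>u + z\<close> and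
  \<open>z\<close> on \<open>T\<close>, and \<open>z\<close> by \<open>u + z\<close> and
  \<open>u\<close> off \<open>T\<close>. After adding, the mass of \<open>z\<close> on
  \<open>T\<close> is absorbed by the null space property.\<close>

lemma nsp_l1_gap:
  assumes "null_space_property \<Phi> K \<gamma>" "\<Phi> *v z = 0" "card T \<le> K"
  shows "(1 - \<gamma>) * (\<Sum>i\<in>- T. \<bar>z $ i\<bar>)
    \<le> l1_norm (u + z) - l1_norm u + 2 * (\<Sum>i\<in>- T. \<bar>u $ i\<bar>)"
proof -
  have "(\<Sum>i\<in>T. \<bar>u $ i\<bar>) \<le> (\<Sum>i\<in>T. \<bar>(u + z) $ i\<bar> + \<bar>z $ i\<bar>)"
    by (intro sum_mono) auto
  moreover have "(\<Sum>i\<in>- T. \<bar>z $ i\<bar>) \<le> (\<Sum>i\<in>- T. \<bar>(u + z) $ i\<bar> + \<bar>u $ i\<bar>)"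
    by (intro sum_mono) auto
  ultimately show ?thesis
    using null_space_propertyD[OF assms] l1_norm_split[of u T] l1_norm_split[of "u + z" T]
    by (simp add: sum.distrib algebra_simps)
qed

section \<open>Runs of the algorithm: feasibility, smoothing parameters and errors\<close>

locale irls_run =
  fixes \<Phi> :: "real ^ 'n ^ 'l"
    and y :: "real ^ 'l"
    and K :: nat
    and \<gamma> \<eta> :: real
    and xstar :: "real ^ 'n"
    and x :: "nat \<Rightarrow> real ^ 'n"
    and \<epsilon> :: "nat \<Rightarrow> real"
  assumes gamma: "0 < \<gamma>" "\<gamma> < 1"
    and nsp: "null_space_property \<Phi> K \<gamma>"
    and feasible_star: "\<Phi> *v xstar = y"
    and sparse: "k_sparse K xstar"
    and eta: "0 < \<eta>" "\<eta> < 1"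
    and irls: "modified_irls \<Phi> y K \<gamma> \<eta> x \<epsilon>"
begin

abbreviation T :: "'n set" where "T \<equiv> vec_support xstar"

definition err :: "nat \<Rightarrow> real" where
  "err n = (\<Sum>i\<in>- T. \<bar>(x n - xstar) $ i\<bar>)"

text \<open>The reciprocal of the IRLS weight of entry \<open>i\<close>, and at the same time a
  smoothed modulus of that entry.\<close>

definition scale :: "nat \<Rightarrow> 'n \<Rightarrow> real" where
  "scale n i = sqrt ((x n $ i)\<^sup>2 + (\<epsilon> n)\<^sup>2)"

text \<open>The smoothed \<open>\<ell>\<^sub>1\<close> norm, used as a Lyapunov function while the
  algorithm runs.\<close>

definition energy :: "nat \<Rightarrow> real" where
  "energy n = (\<Sum>i\<in>UNIV. scale n i)"

lemma card_T: "card T \<le> K"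
  using sparse by (simp add: k_sparse_def)

lemma off_support: "i \<notin> T \<Longrightarrow> xstar $ i = 0"
  by (simp add: vec_support_def)

lemma err_eq: "err n = (\<Sum>i\<in>- T. \<bar>x n $ i\<bar>)"
  unfolding err_def by (intro sum.cong) (auto simp: off_support)

lemma err_nonneg: "0 \<le> err n"
  by (simp add: err_def sum_nonneg)

lemma eps_0: "\<epsilon> 0 = 1"
  using irls by (simp add: modified_irls_def)

lemma stopped:
  assumes "\<epsilon> n = 0"
  shows "x (Suc n) = x n" "\<epsilon> (Suc n) = 0"
  using irls assms by (auto simp: modified_irls_def)

lemma running:
  assumes "\<epsilon> n \<noteq> 0"
  shows "is_arg_min (\<lambda>u. (weighted_norm (irls_weight (x n) (\<epsilon> n)) u)\<^sup>2)
      (\<lambda>u. \<Phi> *v u = y) (x (Suc n))"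
    and "\<epsilon> (Suc n) = min (\<epsilon> n) (\<eta> * (1 - \<gamma>) * sigma_tail K (x (Suc n)) / real CARD('n))"
  using irls assms by (auto simp: modified_irls_def)

text \<open>\<open>x 0\<close> need not be feasible, but \<open>\<epsilon> 0 = 1\<close> makes the
  first step a genuine minimisation over the affine set; a stopped run only repeats a feasible
  vector.\<close>

lemma feasible_Suc: "\<Phi> *v x (Suc n) = y"
proof (induction n)
  case 0
  then show ?case using running(1)[of 0] eps_0 by (simp add: is_arg_min_def)
next
  case (Suc n)
  then show ?case
    using running(1)[of "Suc n"] stopped(1)[of "Suc n"]
    by (cases "\<epsilon> (Suc n) = 0") (auto simp: is_arg_min_def)
qed

lemma feasible: "1 \<le> n \<Longrightarrow> \<Phi> *v x n = y"
  using feasible_Suc[of "n - 1"] by simp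

lemma null_diff: "1 \<le> n \<Longrightarrow> \<Phi> *v (x n - xstar) = 0"
  by (simp add: matrix_vector_mult_diff_distrib feasible feasible_star)

lemma eps_nonneg: "0 \<le> \<epsilon> n"
proof (induction n)
  case (Suc n)
  have "0 \<le> \<eta> * (1 - \<gamma>) * sigma_tail K (x (Suc n)) / real CARD('n)"
    using gamma eta sigma_tail_nonneg[of K "x (Suc n)"] by simp
  then show ?case
    using Suc running(2)[of n] stopped(2)[of n] by (cases "\<epsilon> n = 0") auto
qed (simp add: eps_0)

lemma eps_Suc_le: "\<epsilon> (Suc n) \<le> \<epsilon> n"
  using running(2)[of n] stopped(2)[of n] by (cases "\<epsilon> n = 0") auto

lemma sigma_tail_le_err: "sigma_tail K (x n) \<le> err n"
  unfolding err_eq by (rule sigma_tail_le[OF card_T])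

text \<open>The update rule caps \<open>\<epsilon> n\<close> by a multiple of the tail, which is at
  most the error. Index 0 is excluded because \<open>\<epsilon> 0\<close> is fixed at 1 whatever the
  error.\<close>

lemma eps_le_err:
  assumes "1 \<le> n"
  shows "real CARD('n) * \<epsilon> n \<le> \<eta> * (1 - \<gamma>) * err n"
proof -
  obtain m where m: "n = Suc m" using assms by (cases n) auto
  have nonneg: "0 \<le> \<eta> * (1 - \<gamma>)" using gamma eta by simp
  have "real CARD('n) * \<epsilon> n \<le> \<eta> * (1 - \<gamma>) * sigma_tail K (x n)"
  proof (cases "\<epsilon> m = 0")
    case True
    then show ?thesis
      using stopped(2)[of m] nonneg sigma_tail_nonneg[of K "x n"] by (simp add: m)
  next
    case False
    then have "\<epsilon> n \<le> \<eta> * (1 - \<gamma>) * sigma_tail K (x n) / real CARD('n)"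
      using running(2)[of m] by (simp add: m)
    then show ?thesis by (simp add: field_simps)
  qed
  also have "\<dots> \<le> \<eta> * (1 - \<gamma>) * err n"
    by (intro mult_left_mono sigma_tail_le_err nonneg)
  finally show ?thesis .
qed

text \<open>Two applications of the null space property, with the support of \<open>xstar\<close> and with the set of
  the \<open>K\<close> largest entries of \<open>x n\<close>, bound the two signs of the difference of the norms.\<close>

lemma err_le_sigma_tail:
  assumes "1 \<le> n"
  shows "(1 - \<gamma>) * err n \<le> 2 * sigma_tail K (x n)"
proof -
  obtain S where S: "card S \<le> K" "sigma_tail K (x n) = (\<Sum>i\<in>- S. \<bar>x n $ i\<bar>)"
    by (rule sigma_tail_best_approximation)
  have "(1 - \<gamma>) * err n \<le> l1_norm (x n) - l1_norm xstar"
    using nsp_l1_gap[OF nsp null_diff[OF assms] card_T, of xstar] by (simp add: err_def off_support)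
  moreover have "(1 - \<gamma>) * (\<Sum>i\<in>- S. \<bar>(xstar - x n) $ i\<bar>)
      \<le> l1_norm xstar - l1_norm (x n) + 2 * sigma_tail K (x n)"
    using nsp_l1_gap[OF nsp _ S(1), of "xstar - x n" "x n"] null_diff[OF assms]
    by (simp add: S(2) matrix_vector_mult_diff_distrib)
  moreover have "0 \<le> (1 - \<gamma>) * (\<Sum>i\<in>- S. \<bar>(xstar - x n) $ i\<bar>)"
    using gamma by (simp add: sum_nonneg)
  ultimately show ?thesis by linarith
qed

text \<open>When \<open>\<epsilon>\<close> first vanishes, the minimum is attained by the tail term,
  so the tail and with it the error is 0; later iterates are copies.\<close>

lemma err_zero_if_stopped: "\<epsilon> n = 0 \<Longrightarrow> err n = 0"
proof (induction n)
  case (Suc n)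
  show ?case
  proof (cases "\<epsilon> n = 0")
    case True
    then show ?thesis using Suc.IH stopped(1) by (simp add: err_def)
  next
    case False
    then have "sigma_tail K (x (Suc n)) = 0"
      using running(2)[of n] Suc.prems gamma eta by (auto simp: min_def split: if_splits)
    then have "(1 - \<gamma>) * err (Suc n) \<le> 0"
      using err_le_sigma_tail[of "Suc n"] by simp
    then show ?thesis
      using gamma err_nonneg[of "Suc n"] by (simp add: mult_le_0_iff)
  qed
qed (simp add: eps_0)

section \<open>Scales and stationarity of a step\<close>

lemma scale_pos: "\<epsilon> n \<noteq> 0 \<Longrightarrow> 0 < scale n i"
  by (simp add: scale_def add_nonneg_pos)

lemma scale_nonneg: "0 \<le> scale n i"
  by (simp add: scale_def)

lemma abs_le_scale: "\<bar>x n $ i\<bar> \<le> scale n i"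
  by (simp add: scale_def real_le_rsqrt)

lemma eps_le_scale: "\<epsilon> n \<le> scale n i"
  by (simp add: scale_def real_le_rsqrt)

lemma scale_le: "scale n i \<le> \<bar>x n $ i\<bar> + \<epsilon> n"
  unfolding scale_def using sqrt_sum_squares_le_sum_abs[of "x n $ i" "\<epsilon> n"] eps_nonneg[of n] by simp

lemma step_orthogonal:
  assumes "\<epsilon> n \<noteq> 0" "\<Phi> *v v = 0"
  shows "(\<Sum>i\<in>UNIV. x (Suc n) $ i * v $ i / scale n i) = 0"
  using weighted_minimiser_orthogonal[OF _ running(1)[OF assms(1)] assms(2)]
  by (simp add: irls_weight_nth scale_def)

lemma l1_error_le:
  assumes "1 \<le> n"
  shows "l1_norm (x n - xstar) \<le> (1 + \<gamma>) * err n"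
  using null_space_propertyD[OF nsp null_diff[OF assms] card_T] l1_norm_split[of "x n - xstar" T]
  by (simp add: err_def algebra_simps)

section \<open>Contraction near \<open>xstar\<close>\<close>

text \<open>In the factor, \<open>\<gamma>\<close> comes from the null space property for the new
  error, \<open>1 / (1 - \<rho>)\<close> from the weights on \<open>T\<close>, and
  \<open>1 + \<eta> * (1 - \<gamma>)\<close> from the sum of the scales off
  \<open>T\<close>.\<close>

lemma contraction:
  assumes n: "1 \<le> n" and rho: "0 < \<rho>" "\<rho> < 1"
    and small: "\<And>i. i \<in> T \<Longrightarrow> err n \<le> \<rho> * \<bar>xstar $ i\<bar>"
  shows "err (Suc n) \<le> \<gamma> * (1 + \<eta> * (1 - \<gamma>)) / (1 - \<rho>) * err n"
proof (cases "\<epsilon> n = 0")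
  case True
  then show ?thesis
    using err_zero_if_stopped stopped(2) by simp
next
  case False
  define \<xi> where "\<xi> = x (Suc n) - xstar"
  note pos = scale_pos[OF False]
  have null: "\<Phi> *v \<xi> = 0" using null_diff[of "Suc n"] by (simp add: \<xi>_def)
  \<comment> \<open>By the null space property the deviation on \<open>T\<close> is also at most
    \<open>err n\<close>, so each entry of \<open>x n\<close> there keeps a fraction
    \<open>1 - \<rho>\<close> of the modulus of \<open>xstar\<close>.\<close>
  have ratio: "\<bar>xstar $ i\<bar> / scale n i \<le> 1 / (1 - \<rho>)" if i: "i \<in> T" for i
  proof -
    have "\<bar>(x n - xstar) $ i\<bar> \<le> (\<Sum>i\<in>T. \<bar>(x n - xstar) $ i\<bar>)"
      using i by (intro member_le_sum) auto
    also have "\<dots> \<le> \<gamma> * err n"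
      using null_space_propertyD[OF nsp null_diff[OF n] card_T] by (simp add: err_def)
    also have "\<dots> \<le> err n" using gamma err_nonneg[of n] by (simp add: mult_left_le_one_le)
    also have "\<dots> \<le> \<rho> * \<bar>xstar $ i\<bar>" by (rule small[OF i])
    finally have "(1 - \<rho>) * \<bar>xstar $ i\<bar> \<le> \<bar>x n $ i\<bar>" by (simp add: algebra_simps)
    also have "\<dots> \<le> scale n i" by (rule abs_le_scale)
    finally show ?thesis using pos[of i] rho by (simp add: field_simps)
  qed
  \<comment> \<open>Orthogonality to \<open>\<xi>\<close>, with \<open>x (Suc n)\<close> written as
    \<open>xstar + \<xi>\<close>; on the right only the support of \<open>xstar\<close>
    contributes.\<close>
  have "(\<Sum>i\<in>UNIV. (\<xi> $ i)\<^sup>2 / scale n i) = (\<Sum>i\<in>UNIV. - (xstar $ i * \<xi> $ i / scale n i))"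
  proof -
    have "(\<Sum>i\<in>UNIV. (\<xi> $ i)\<^sup>2 / scale n i + xstar $ i * \<xi> $ i / scale n i)
        = (\<Sum>i\<in>UNIV. x (Suc n) $ i * \<xi> $ i / scale n i)"
      by (intro sum.cong)
        (simp_all add: \<xi>_def power2_eq_square algebra_simps flip: add_divide_distrib)
    then show ?thesis
      using step_orthogonal[OF False null] by (simp add: sum.distrib sum_negf)
  qed
  also have "\<dots> = (\<Sum>i\<in>T. - (xstar $ i * \<xi> $ i / scale n i))"
    by (intro sum.mono_neutral_right) (auto simp: off_support)
  also have "\<dots> \<le> (\<Sum>i\<in>T. 1 / (1 - \<rho>) * \<bar>\<xi> $ i\<bar>)"
  proof (intro sum_mono)
    fix i assume i: "i \<in> T"
    have "- (xstar $ i * \<xi> $ i / scale n i) \<le> \<bar>xstar $ i * \<xi> $ i / scale n i\<bar>" by linarith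
    also have "\<dots> = \<bar>xstar $ i\<bar> / scale n i * \<bar>\<xi> $ i\<bar>"
      using pos[of i] by (simp add: abs_mult)
    also have "\<dots> \<le> 1 / (1 - \<rho>) * \<bar>\<xi> $ i\<bar>"
      by (intro mult_right_mono ratio i) simp
    finally show "- (xstar $ i * \<xi> $ i / scale n i) \<le> 1 / (1 - \<rho>) * \<bar>\<xi> $ i\<bar>" .
  qed
  also have "\<dots> = 1 / (1 - \<rho>) * (\<Sum>i\<in>T. \<bar>\<xi> $ i\<bar>)" by (simp add: sum_distrib_left)
  also have "\<dots> \<le> 1 / (1 - \<rho>) * (\<gamma> * err (Suc n))"
    using null_space_propertyD[OF nsp null card_T] rho
    by (intro mult_left_mono) (auto simp: err_def \<xi>_def)
  finally have energy: "(\<Sum>i\<in>UNIV. (\<xi> $ i)\<^sup>2 / scale n i) \<le> \<gamma> / (1 - \<rho>) * err (Suc n)" by simp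
  have scales: "(\<Sum>i\<in>- T. scale n i) \<le> (1 + \<eta> * (1 - \<gamma>)) * err n"
  proof -
    have "(\<Sum>i\<in>- T. scale n i) \<le> (\<Sum>i\<in>- T. \<bar>x n $ i\<bar> + \<epsilon> n)"
      by (intro sum_mono scale_le)
    also have "\<dots> = err n + real (card (- T)) * \<epsilon> n"
      by (simp add: sum.distrib err_eq)
    also have "\<dots> \<le> err n + real CARD('n) * \<epsilon> n"
      by (intro add_left_mono mult_right_mono eps_nonneg) (simp add: card_mono)
    also have "\<dots> \<le> err n + \<eta> * (1 - \<gamma>) * err n"
      using eps_le_err[OF n] by simp
    finally show ?thesis by (simp add: algebra_simps)
  qed
  \<comment> \<open>Each modulus is written as weight times modulus times scale, ready for the
    weighted Cauchy-Schwarz inequality.\<close>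
  have "(err (Suc n))\<^sup>2 = (\<Sum>i\<in>- T. 1 / scale n i * \<bar>\<xi> $ i\<bar> * scale n i)\<^sup>2"
    unfolding err_def \<xi>_def using pos
    by (intro arg_cong[where f = "\<lambda>r. r\<^sup>2"] sum.cong) (auto simp: less_imp_neq[symmetric])
  also have "\<dots> \<le> (\<Sum>i\<in>- T. 1 / scale n i * \<bar>\<xi> $ i\<bar>\<^sup>2) * (\<Sum>i\<in>- T. 1 / scale n i * (scale n i)\<^sup>2)"
    using scale_nonneg by (intro weighted_Cauchy_Schwarz) simp
  also have "(\<Sum>i\<in>- T. 1 / scale n i * (scale n i)\<^sup>2) = (\<Sum>i\<in>- T. scale n i)"
    by (intro sum.cong) (simp_all add: power2_eq_square)
  also have "(\<Sum>i\<in>- T. 1 / scale n i * \<bar>\<xi> $ i\<bar>\<^sup>2) = (\<Sum>i\<in>- T. (\<xi> $ i)\<^sup>2 / scale n i)"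
    by simp
  also have "(\<Sum>i\<in>- T. (\<xi> $ i)\<^sup>2 / scale n i) * (\<Sum>i\<in>- T. scale n i)
      \<le> (\<Sum>i\<in>UNIV. (\<xi> $ i)\<^sup>2 / scale n i) * (\<Sum>i\<in>- T. scale n i)"
    using scale_nonneg by (intro mult_right_mono sum_mono2 sum_nonneg) auto
  also have "\<dots> \<le> (\<gamma> / (1 - \<rho>) * err (Suc n)) * ((1 + \<eta> * (1 - \<gamma>)) * err n)"
    using gamma rho err_nonneg[of "Suc n"] scale_nonneg
    by (intro mult_mono energy scales sum_nonneg) auto
  finally have "err (Suc n) * err (Suc n)
      \<le> err (Suc n) * (\<gamma> * (1 + \<eta> * (1 - \<gamma>)) / (1 - \<rho>) * err n)"
    by (simp add: power2_eq_square mult_ac)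
  moreover have "0 \<le> \<gamma> * (1 + \<eta> * (1 - \<gamma>)) / (1 - \<rho>) * err n"
    using gamma eta rho err_nonneg[of n] by simp
  \<comment> \<open>One factor \<open>err (Suc n)\<close> cancels; if it is 0, the claim is the
    nonnegativity of the right-hand side.\<close>
  ultimately show ?thesis
    using err_nonneg[of "Suc n"]
    by (cases "err (Suc n) = 0") (simp, metis mult_le_cancel_left_pos order_le_imp_less_or_eq)
qed

section \<open>Energy decay and its consequence for the errors\<close>

text \<open>Lowering \<open>\<epsilon>\<close> only lowers the scales, and concavity of the square
  root bounds the new scales by a quadratic with the current weights. Its part linear in the
  increment, taken at \<open>x (Suc n)\<close>, sums to 0 by stationarity.\<close>

lemma energy_decrease:
  assumes n: "1 \<le> n" and eps: "\<epsilon> n \<noteq> 0"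
  shows "(\<Sum>i\<in>UNIV. (x (Suc n) $ i - x n $ i)\<^sup>2 / scale n i) \<le> 2 * (energy n - energy (Suc n))"
proof -
  note pos = scale_pos[OF eps]
  have null: "\<Phi> *v (x (Suc n) - x n) = 0"
    by (simp add: matrix_vector_mult_diff_distrib feasible[OF n] feasible_Suc)
  have "scale (Suc n) i \<le> scale n i + x (Suc n) $ i * (x (Suc n) - x n) $ i / scale n i
      - (x (Suc n) $ i - x n $ i)\<^sup>2 / scale n i / 2" for i
  proof -
    have "scale (Suc n) i \<le> sqrt ((x (Suc n) $ i)\<^sup>2 + (\<epsilon> n)\<^sup>2)"
      unfolding scale_def using eps_Suc_le[of n] eps_nonneg[of "Suc n"]
      by (simp add: power_mono)
    also have "\<dots> \<le> scale n i + ((x (Suc n) $ i)\<^sup>2 - (x n $ i)\<^sup>2) / (2 * scale n i)"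
      using sqrt_le_tangent[of "(x (Suc n) $ i)\<^sup>2 + (\<epsilon> n)\<^sup>2" "(x n $ i)\<^sup>2 + (\<epsilon> n)\<^sup>2"] eps
      by (simp add: scale_def add_nonneg_pos)
    also have "\<dots> = scale n i + x (Suc n) $ i * (x (Suc n) - x n) $ i / scale n i
      - (x (Suc n) $ i - x n $ i)\<^sup>2 / scale n i / 2"
      using pos[of i] by (simp add: field_simps power2_eq_square)
    finally show ?thesis .
  qed
  then have "energy (Suc n) \<le> (\<Sum>i\<in>UNIV. scale n i + x (Suc n) $ i * (x (Suc n) - x n) $ i / scale n i
      - (x (Suc n) $ i - x n $ i)\<^sup>2 / scale n i / 2)"
    unfolding energy_def by (intro sum_mono)
  also have "\<dots> = energy n - (\<Sum>i\<in>UNIV. (x (Suc n) $ i - x n $ i)\<^sup>2 / scale n i) / 2"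
    using step_orthogonal[OF eps null]
    by (simp add: sum.distrib sum_subtractf energy_def sum_divide_distrib)
  finally show ?thesis by simp
qed

text \<open>Convexity of the smoothed norm along the segment from \<open>x n\<close> to \<open>xstar\<close>; by stationarity of
  \<open>x (Suc n)\<close> the slope at \<open>x n\<close> involves only the increment of the iteration.\<close>

lemma err_le_increment:
  assumes n: "1 \<le> n" and eps: "\<epsilon> n \<noteq> 0"
  shows "(1 - \<eta>) * (1 - \<gamma>) * err n
    \<le> (\<Sum>i\<in>UNIV. 1 / scale n i * (x (Suc n) $ i - x n $ i) * (xstar $ i - x n $ i))"
proof -
  let ?D = "\<Sum>i\<in>UNIV. 1 / scale n i * (x (Suc n) $ i - x n $ i) * (xstar $ i - x n $ i)"
  have null: "\<Phi> *v (xstar - x n) = 0"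
    by (simp add: matrix_vector_mult_diff_distrib feasible[OF n] feasible_star)
  have conv: "scale n i + x n $ i * (xstar $ i - x n $ i) / scale n i \<le> \<bar>xstar $ i\<bar> + \<epsilon> n" for i
    using sqrt_sq_add_ge_tangent[OF eps, of "x n $ i" "xstar $ i"]
      sqrt_sum_squares_le_sum_abs[of "xstar $ i" "\<epsilon> n"] eps_nonneg[of n]
    by (simp add: scale_def)
  have "l1_norm (x n) \<le> energy n"
    unfolding l1_norm_def energy_def by (intro sum_mono abs_le_scale)
  moreover have "energy n - ?D \<le> l1_norm xstar + real CARD('n) * \<epsilon> n"
  proof -
    have "energy n - ?D = energy n - ?D + (\<Sum>i\<in>UNIV. x (Suc n) $ i * (xstar - x n) $ i / scale n i)"
      using step_orthogonal[OF eps null] by simp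
    also have "\<dots> = (\<Sum>i\<in>UNIV. scale n i + x n $ i * (xstar $ i - x n $ i) / scale n i)"
      unfolding energy_def sum.distrib[symmetric] sum_subtractf[symmetric]
      by (intro sum.cong) (simp_all add: diff_divide_distrib algebra_simps)
    also have "\<dots> \<le> (\<Sum>i\<in>UNIV. \<bar>xstar $ i\<bar> + \<epsilon> n)"
      by (intro sum_mono conv)
    finally show ?thesis by (simp add: sum.distrib l1_norm_def)
  qed
  moreover have "(1 - \<gamma>) * err n \<le> l1_norm (x n) - l1_norm xstar"
    using nsp_l1_gap[OF nsp null_diff[OF n] card_T, of xstar] by (simp add: err_def off_support)
  \<comment> \<open>The total smoothing error is at most
    \<open>\<eta> * (1 - \<gamma>) * err n\<close>, which turns \<open>1 - \<gamma>\<close> into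
    \<open>(1 - \<eta>) * (1 - \<gamma>)\<close>.\<close>
  ultimately show ?thesis
    using eps_le_err[OF n] by (simp add: algebra_simps)
qed

lemma err_tendsto_zero_if_eps_bounded_below:
  assumes "0 < \<delta>" and below: "\<And>n. \<delta> \<le> \<epsilon> n"
  shows "err \<longlonglongrightarrow> 0"
proof -
  have eps: "\<epsilon> n \<noteq> 0" for n using assms(1) below[of n] by linarith
  have scale_ge: "\<delta> \<le> scale n i" for n i using below[of n] eps_le_scale[of n i] by linarith
  \<comment> \<open>The shift skips \<open>x 0\<close>, which may be infeasible.\<close>
  define E where "E n = energy (Suc n)" for n
  have step: "0 \<le> E n - E (Suc n)" for n
  proof -
    have "0 \<le> (\<Sum>i\<in>UNIV. (x (Suc (Suc n)) $ i - x (Suc n) $ i)\<^sup>2 / scale (Suc n) i)"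
      using scale_nonneg by (intro sum_nonneg) auto
    then show ?thesis
      using energy_decrease[OF _ eps, of "Suc n"] by (simp add: E_def)
  qed
  then have dec: "decseq E" by (intro decseq_SucI) simp
  have "0 \<le> E n" for n
    unfolding E_def energy_def using scale_nonneg by (intro sum_nonneg) auto
  then have "convergent E"
    using dec by (metis Bseq_monoseq_convergent decseq_bounded decseq_imp_monoseq)
  then obtain L where L: "E \<longlonglongrightarrow> L" by (auto simp: convergent_def)
  have gap: "(\<lambda>n. E n - E (Suc n)) \<longlonglongrightarrow> 0"
    using tendsto_diff[OF L LIMSEQ_Suc[OF L]] by simp
  \<comment> \<open>Bounds the second Cauchy-Schwarz factor: entries of \<open>x (Suc n)\<close>
    have modulus at most \<open>E 0\<close> by monotonicity, and scales are at least
    \<open>\<delta>\<close>.\<close>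
  define B where "B = (\<Sum>i\<in>UNIV. (\<bar>xstar $ i\<bar> + E 0)\<^sup>2 / \<delta>)"
  define c where "c = (1 - \<eta>) * (1 - \<gamma>)"
  have c: "0 < c" using eta gamma by (simp add: c_def)
  have bound: "(c * err (Suc n))\<^sup>2 \<le> 2 * (E n - E (Suc n)) * B" for n
  proof -
    have "(c * err (Suc n))\<^sup>2 \<le>
      (\<Sum>i\<in>UNIV. 1 / scale (Suc n) i * (x (Suc (Suc n)) $ i - x (Suc n) $ i) * (xstar $ i - x (Suc n) $ i))\<^sup>2"
      using err_le_increment[OF _ eps, of "Suc n"] c err_nonneg[of "Suc n"]
      by (intro power_mono) (auto simp: c_def)
    also have "\<dots> \<le> (\<Sum>i\<in>UNIV. 1 / scale (Suc n) i * (x (Suc (Suc n)) $ i - x (Suc n) $ i)\<^sup>2)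
        * (\<Sum>i\<in>UNIV. 1 / scale (Suc n) i * (xstar $ i - x (Suc n) $ i)\<^sup>2)"
      using scale_nonneg by (intro weighted_Cauchy_Schwarz) simp
    also have "\<dots> \<le> (2 * (E n - E (Suc n))) * B"
    proof (rule mult_mono)
      show "(\<Sum>i\<in>UNIV. 1 / scale (Suc n) i * (x (Suc (Suc n)) $ i - x (Suc n) $ i)\<^sup>2)
          \<le> 2 * (E n - E (Suc n))"
        using energy_decrease[OF _ eps, of "Suc n"] by (simp add: E_def)
      show "(\<Sum>i\<in>UNIV. 1 / scale (Suc n) i * (xstar $ i - x (Suc n) $ i)\<^sup>2) \<le> B"
        unfolding B_def
      proof (rule sum_mono)
        fix i :: 'n
        have "\<bar>x (Suc n) $ i\<bar> \<le> scale (Suc n) i" by (rule abs_le_scale)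
        also have "\<dots> \<le> E n"
          unfolding E_def energy_def using scale_nonneg by (intro member_le_sum) auto
        also have "\<dots> \<le> E 0" using dec by (simp add: decseq_def)
        finally have "\<bar>xstar $ i - x (Suc n) $ i\<bar> \<le> \<bar>xstar $ i\<bar> + E 0" by linarith
        then have "(xstar $ i - x (Suc n) $ i)\<^sup>2 \<le> (\<bar>xstar $ i\<bar> + E 0)\<^sup>2"
          by (rule abs_le_square_iff[THEN iffD1, OF order_trans]) simp
        then have "(xstar $ i - x (Suc n) $ i)\<^sup>2 / scale (Suc n) i \<le> (\<bar>xstar $ i\<bar> + E 0)\<^sup>2 / \<delta>"
          using scale_ge[of "Suc n" i] assms(1) by (intro frac_le) auto
        then show "1 / scale (Suc n) i * (xstar $ i - x (Suc n) $ i)\<^sup>2 \<le> (\<bar>xstar $ i\<bar> + E 0)\<^sup>2 / \<delta>"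
          by simp
      qed
      show "0 \<le> 2 * (E n - E (Suc n))" using step[of n] by simp
      show "0 \<le> (\<Sum>i\<in>UNIV. 1 / scale (Suc n) i * (xstar $ i - x (Suc n) $ i)\<^sup>2)"
        using scale_nonneg by (intro sum_nonneg) auto
    qed
    finally show ?thesis .
  qed
  have "(\<lambda>n. (c * err (Suc n))\<^sup>2) \<longlonglongrightarrow> 0"
  proof (rule tendsto_sandwich[of "\<lambda>_. 0"])
    show "(\<lambda>n. 2 * (E n - E (Suc n)) * B) \<longlonglongrightarrow> 0"
      using tendsto_mult_right[OF tendsto_mult_left[OF gap, of 2], of B] by simp
    show "\<forall>\<^sub>F n in sequentially. (c * err (Suc n))\<^sup>2 \<le> 2 * (E n - E (Suc n)) * B"
      using bound by simp
    show "(\<lambda>_. 0::real) \<longlonglongrightarrow> 0" by simp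
  qed simp
  then have "(\<lambda>n. sqrt ((c * err (Suc n))\<^sup>2)) \<longlonglongrightarrow> sqrt 0"
    by (rule tendsto_real_sqrt)
  then have "(\<lambda>n. c * err (Suc n)) \<longlonglongrightarrow> 0"
    using c err_nonneg by (simp add: real_sqrt_abs abs_mult)
  then have "(\<lambda>n. c * err (Suc n) / c) \<longlonglongrightarrow> 0 / c"
    using c by (intro tendsto_intros) auto
  then show ?thesis
    using c by (simp add: filterlim_sequentially_Suc)
qed

section \<open>Reaching an arbitrarily small error\<close>

lemma err_eventually_small:
  assumes "0 < \<tau>"
  shows "\<exists>n\<ge>1. err n \<le> \<tau>"
proof -
  \<comment> \<open>One factor \<open>1 - \<gamma>\<close> undoes the update rule for
    \<open>\<epsilon>\<close>; the other, with the 2, is the loss in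
    \<open>err_le_sigma_tail\<close>. The cap 1 ensures that index 0 is not below
    \<open>\<delta>\<close>.\<close>
  define \<delta> where "\<delta> = min 1 (\<eta> * (1 - \<gamma>)\<^sup>2 * \<tau> / (2 * real CARD('n)))"
  have delta: "0 < \<delta>" "\<delta> \<le> 1" using assms eta gamma by (auto simp: \<delta>_def)
  show ?thesis
  proof (cases "\<forall>n. \<delta> \<le> \<epsilon> n")
    case True
    then have "err \<longlonglongrightarrow> 0"
      using delta by (intro err_tendsto_zero_if_eps_bounded_below) auto
    then have "\<forall>\<^sub>F n in sequentially. err n < \<tau>"
      using assms by (rule order_tendstoD)
    then obtain N where "\<And>n. N \<le> n \<Longrightarrow> err n < \<tau>"
      by (auto simp: eventually_sequentially)
    then have "1 \<le> Suc N" "err (Suc N) \<le> \<tau>" by (auto intro: less_imp_le)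
    then show ?thesis by blast
  next
    case False
    \<comment> \<open>At the first index with \<open>\<epsilon> k < \<delta>\<close> the minimum defining \<open>\<epsilon> k\<close> is attained by its second argument.\<close>
    define k where "k = (LEAST n. \<epsilon> n < \<delta>)"
    have k: "\<epsilon> k < \<delta>" 
      unfolding k_def using False LeastI_ex[of "\<lambda>n. \<epsilon> n < \<delta>"] by (simp add: not_le)
    then obtain m where m: "k = Suc m" using delta(2) eps_0 by (cases k) auto
    have "\<delta> \<le> \<epsilon> m" using not_less_Least[of m "\<lambda>n. \<epsilon> n < \<delta>"] m by (simp add: k_def)
    then have "\<epsilon> k = \<eta> * (1 - \<gamma>) * sigma_tail K (x k) / real CARD('n)"
      using running(2)[of m] k delta(1) by (auto simp: m min_def split: if_splits)
    then have "\<eta> * (1 - \<gamma>) * sigma_tail K (x k) = real CARD('n) * \<epsilon> k" by simp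
    also have "\<dots> \<le> real CARD('n) * (\<eta> * (1 - \<gamma>)\<^sup>2 * \<tau> / (2 * real CARD('n)))"
      using k by (intro mult_left_mono) (auto simp: \<delta>_def)
    also have "\<dots> = \<eta> * (1 - \<gamma>) * ((1 - \<gamma>) * \<tau> / 2)"
      by (simp add: power2_eq_square)
    finally have "sigma_tail K (x k) \<le> (1 - \<gamma>) * \<tau> / 2"
      using eta gamma by simp
    then have "(1 - \<gamma>) * err k \<le> (1 - \<gamma>) * \<tau>"
      using err_le_sigma_tail[of k] m by simp
    then have "err k \<le> \<tau>" using gamma by simp
    then show ?thesis using m by (intro exI[of _ k]) simp
  qed
qed

end

section \<open>The threshold condition and the final estimates\<close>

text \<open>For empty \<open>A\<close> both sides hold: since \<open>\<rho>\<close> is positive, its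
  product with infinity is infinity and not 0.\<close>

lemma le_ereal_mult_min_or_infty_iff:
  assumes "finite A" "0 < \<rho>"
  shows "ereal a \<le> ereal \<rho> * min_or_infty A \<longleftrightarrow> (\<forall>r\<in>A. a \<le> \<rho> * r)"
proof (cases "A = {}")
  case True
  then show ?thesis using assms by (simp add: min_or_infty_def)
next
  case False
  have "(\<forall>r\<in>A. a \<le> \<rho> * r) \<longleftrightarrow> (\<forall>r\<in>A. a / \<rho> \<le> r)"
    using assms by (simp add: divide_le_eq mult.commute)
  also have "\<dots> \<longleftrightarrow> a / \<rho> \<le> Min A" using assms False by simp
  also have "\<dots> \<longleftrightarrow> a \<le> \<rho> * Min A" using assms by (simp add: divide_le_eq mult.commute)
  finally show ?thesis using False by (simp add: min_or_infty_def)
qed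

theorem theorem3p6:
  fixes \<Phi> :: "real ^ 'n ^ 'l"
    and y :: "real ^ 'l"
    and K :: nat
    and \<gamma> \<eta> \<rho> \<mu> :: real
    and xstar :: "real ^ 'n"
    and x :: "nat \<Rightarrow> real ^ 'n"
    and \<epsilon> :: "nat \<Rightarrow> real"
    and T :: "'n set"
  assumes "CARD('l) < CARD('n)"
    and "0 < K"
    and "0 < \<gamma>" and "\<gamma> < 1"
    and "null_space_property \<Phi> K \<gamma>"
    and "\<Phi> *v xstar = y" and "k_sparse K xstar"
    and "0 < \<eta>" and "\<eta> < 1"
    and "modified_irls \<Phi> y K \<gamma> \<eta> x \<epsilon>"
    and "T = vec_support xstar"
    and "0 < \<rho>" and "\<rho> < 1 - \<gamma> * (1 + \<eta> * (1 - \<gamma>))"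
    and "\<mu> = \<gamma> * (1 + \<eta> * (1 - \<gamma>)) / (1 - \<rho>)"
  shows "\<mu> < 1 \<and>
    (\<exists>n0\<ge>1.
      ereal (l1_norm (vec_restrict (- T) (x n0 - xstar)))
        \<le> ereal \<rho> * min_or_infty ((\<lambda>i. \<bar>xstar $ i\<bar>) ` T) \<and>
      (\<forall>m. 1 \<le> m \<and>
           ereal (l1_norm (vec_restrict (- T) (x m - xstar)))
             \<le> ereal \<rho> * min_or_infty ((\<lambda>i. \<bar>xstar $ i\<bar>) ` T)
           \<longrightarrow> n0 \<le> m) \<and>
      (\<forall>n\<ge>n0.
        l1_norm (vec_restrict (- T) (x (Suc n) - xstar))
          \<le> \<mu> * l1_norm (vec_restrict (- T) (x n - xstar)) \<and>
        l1_norm (x n - xstar)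
          \<le> (1 + \<gamma>) * \<mu> ^ (n - n0) * l1_norm (x n0 - xstar)))"
proof -
  interpret irls_run \<Phi> y K \<gamma> \<eta> xstar x \<epsilon>
    by unfold_locales (use assms in auto)
  have pos: "0 < \<gamma> * (1 + \<eta> * (1 - \<gamma>))" using gamma eta by (simp add: add_pos_pos)
  then have rho: "0 < \<rho>" "\<rho> < 1" using assms(12,13) by auto
  \<comment> \<open>The upper bound on \<open>\<rho>\<close> says that the numerator of
    \<open>\<mu>\<close> is below \<open>1 - \<rho>\<close>.\<close>
  have mu: "0 < \<mu>" "\<mu> < 1" using pos rho assms(13,14) by (auto simp: divide_less_eq)
  have err: "l1_norm (vec_restrict (- T) (x n - xstar)) = err n" for n
    by (simp add: l1_norm_vec_restrict err_def assms(11))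
  define small where "small n \<longleftrightarrow> (\<forall>i\<in>vec_support xstar. err n \<le> \<rho> * \<bar>xstar $ i\<bar>)" for n
  have small_iff: "ereal (err n) \<le> ereal \<rho> * min_or_infty ((\<lambda>i. \<bar>xstar $ i\<bar>) ` T) \<longleftrightarrow> small n" for n
    using rho by (subst le_ereal_mult_min_or_infty_iff) (auto simp: small_def assms(11))
  have "\<exists>n. 1 \<le> n \<and> small n"
  proof -
    \<comment> \<open>The inserted 1 keeps the set nonempty when \<open>xstar = 0\<close>.\<close>
    define \<tau> where "\<tau> = Min (insert 1 ((\<lambda>i. \<rho> * \<bar>xstar $ i\<bar>) ` T))"
    have "0 < \<tau>" using rho by (auto simp: \<tau>_def assms(11) vec_support_def)
    then obtain n where "1 \<le> n" "err n \<le> \<tau>" using err_eventually_small by blast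
    moreover have "\<tau> \<le> \<rho> * \<bar>xstar $ i\<bar>" if "i \<in> vec_support xstar" for i
      unfolding \<tau>_def using that by (intro Min_le) (auto simp: assms(11))
    ultimately show ?thesis unfolding small_def by (meson order_trans)
  qed
  define n0 where "n0 = (LEAST n. 1 \<le> n \<and> small n)"
  have n0: "1 \<le> n0" "small n0"
    using LeastI_ex[OF \<open>\<exists>n. 1 \<le> n \<and> small n\<close>] by (auto simp: n0_def)
  have least: "n0 \<le> m" if "1 \<le> m" "small m" for m
    unfolding n0_def using that by (intro Least_le) simp
  have contract: "err (Suc n) \<le> \<mu> * err n" if "1 \<le> n" "small n" for n
    using contraction[OF that(1) rho] that(2) by (simp add: small_def assms(14))
  \<comment> \<open>The contraction makes the error nonincreasing, so the threshold remains
    satisfied and the contraction applies again.\<close>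
  have persist: "small n" if "n0 \<le> n" for n
    using that
  proof (induction n rule: dec_induct)
    case (step n)
    have "err (Suc n) \<le> \<mu> * err n" using contract step n0 by simp
    also have "\<dots> \<le> err n" using mu err_nonneg[of n] by (simp add: mult_left_le_one_le)
    finally show ?case using step.IH unfolding small_def by (meson order_trans)
  qed (rule n0)
  have power: "err n \<le> \<mu> ^ (n - n0) * err n0" if "n0 \<le> n" for n
    using that
  proof (induction n rule: dec_induct)
    case (step n)
    have "err (Suc n) \<le> \<mu> * err n" using contract[of n] persist[of n] step n0 by simp
    also have "\<dots> \<le> \<mu> * (\<mu> ^ (n - n0) * err n0)" using step.IH mu by (intro mult_left_mono) auto
    finally show ?case using step by (simp add: Suc_diff_le)
  qed simp
  have norm: "l1_norm (x n - xstar) \<le> (1 + \<gamma>) * \<mu> ^ (n - n0) * l1_norm (x n0 - xstar)"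
    if "n0 \<le> n" for n
  proof -
    have "l1_norm (x n - xstar) \<le> (1 + \<gamma>) * err n"
      using that n0 by (intro l1_error_le) simp
    also have "\<dots> \<le> (1 + \<gamma>) * (\<mu> ^ (n - n0) * err n0)"
      using gamma power[OF that] by simp
    also have "\<dots> \<le> (1 + \<gamma>) * (\<mu> ^ (n - n0) * l1_norm (x n0 - xstar))"
    proof -
      have "err n0 \<le> l1_norm (x n0 - xstar)"
        unfolding err_def l1_norm_def by (intro sum_mono2) auto
      then show ?thesis using gamma mu by (intro mult_left_mono) auto
    qed
    finally show ?thesis by (simp add: mult.assoc)
  qed
  show ?thesis
    unfolding err small_iff
  proof (intro conjI exI[of _ n0] allI impI)
    show "err (Suc n) \<le> \<mu> * err n" if "n0 \<le> n" for n
      using that n0(1) persist contract by simp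
  qed (use mu n0 least norm in blast)+
qed

end
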